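(* Let $K\subset\mathbb{R}^p$ be a closed convex cone, let $\bar A$ be a $p\times p$ symmetric positive semidefinite matrix with largest and second largest eigenvalues $\lambda,\mu$ and eigengap $\nu=\lambda-\mu>0$, and let $\bar x\in K\cap\mathbb{S}^{p-1}$ be a unit eigenvector of $\bar A$ for the eigenvalue $\lambda$. Let $A=\bar A+E$ be symmetric positive semidefinite, and assume $\nu\ge(3+2\sqrt2)\|E\|_K$. Let $v_0\in\mathbb{S}^{p-1}$ satisfy $v_0^\top\bar x\ge c_0$ with $c_0>c_{-1}$. Let $v_+$ and $v_-$ be the outputs of the cone projected power iteration (with a common stopping threshold $\Delta$) initialized at $v_0$ and at $-v_0$ respectively. If $v_-^\top A v_-\ge v_+^\top A v_+$ (so that the two-start procedure, which returns the element of $\{v_+,v_-\}$ with the larger value of $v^\top A v$, returns $v_-$), then $$\|v_--\bar x\|\wedge\|v_-+\bar x\|\le B_1\wedge B_2,$$ where $$B_1=\sqrt{\frac{2\lambda}{\nu}}\,\|v_+-\bar x\|+\sqrt{\frac{4\|E\|_K}{\nu}},$$ $$B_2=\left(\frac{8\|E\|_K}{\nu}\vee\frac{8\|E\|_{\mathcal{T}_K(\bar x)}}{\nu}\right)+\sqrt{\frac{2\lambda\|v_+-\bar x\|^2+8\|v_+-\bar x\|\,\|E\|_{\mathcal{T}_K(\bar x)}}{\nu}}.$$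
   Context: $\|\cdot\|$ is the Euclidean norm, $\mathbb{S}^{p-1}$ the unit sphere of $\mathbb{R}^p$, $a\wedge b=\min(a,b)$, $a\vee b=\max(a,b)$. Eigenvalues are counted with multiplicity. $\Pi_K v=\arg\min_{x\in K}\|v-x\|$. The cone projected power iteration initialized at a vector $w_0$ computes $w_{s}=\Pi_K A w_{s-1}/\|\Pi_K A w_{s-1}\|$ for $s\ge1$ and outputs $w_{s}$ for the first $s\ge 1$ with $\|w_{s}-w_{s-1}\|\le\Delta$; both runs are assumed to be well defined and to stop (in particular the outputs lie in $K\cap\mathbb{S}^{p-1}$). For a cone $C\subset\mathbb{R}^p$, $\|E\|_C=\sup_{x,y\in C\cap\mathbb{S}^{p-1}}|x^\top E y|$. The tangent cone of $K$ at $\bar x$ is $\mathcal{T}_K(\bar x)=\{t(v-\bar x): t\ge 0,\ v\in K\}$. The constant $c_{-1}$ is $$c_{-1}=\frac{\nu-\|E\|_K-\sqrt{(\nu-\|E\|_K)^2-4\nu\|E\|_K}}{2\nu}.$$ *)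

theory Defs
  imports "HOL-Analysis.Analysis" "HOL-Library.Multiset"
begin

definition sym_psd :: "real^'n^'n \<Rightarrow> bool" where
  "sym_psd A \<longleftrightarrow> transpose A = A \<and> (\<forall>x. 0 \<le> x \<bullet> (A *v x))"

definition eigenspace :: "real^'n^'n \<Rightarrow> real \<Rightarrow> (real^'n) set" where
  "eigenspace A c = {v. A *v v = c *\<^sub>R v}"

text \<open>
  Each eigenvalue is repeated according to the dimension of its eigenspace. The definition is used
  for symmetric matrices only, where geometric and algebraic multiplicities agree, so that the
  multiset has exactly \<open>CARD('n)\<close> elements. The summation range is finite by
  \<open>finite_eigenvalues\<close> below.
\<close>
definition eigenvalues :: "real^'n^'n \<Rightarrow> real multiset" where
  "eigenvalues A = (\<Sum>c | eigenspace A c \<noteq> {0}. replicate_mset (dim (eigenspace A c)) c)"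

text \<open>Counting from 0: index 0 is the largest eigenvalue, index 1 the second largest.\<close>
definition eigenvalues_desc :: "real^'n^'n \<Rightarrow> real list" where
  "eigenvalues_desc A = rev (sorted_list_of_multiset (eigenvalues A))"

lemma finite_eigenvalues:
  fixes A :: "real^'n^'n"
  assumes "transpose A = A"
  shows "finite {c. eigenspace A c \<noteq> {0}}"
proof -
  let ?S = "{c. eigenspace A c \<noteq> {0}}"
  have zero: "0 \<in> eigenspace A c" for c
    by (simp add: eigenspace_def)
  have "\<exists>v. v \<noteq> 0 \<and> A *v v = c *\<^sub>R v" if "c \<in> ?S" for c
    using that zero[of c] unfolding eigenspace_def by blast
  then obtain f where f: "\<And>c. c \<in> ?S \<Longrightarrow> f c \<noteq> 0 \<and> A *v f c = c *\<^sub>R f c"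
    by metis
  have orth: "f c \<bullet> f d = 0" if "c \<in> ?S" "d \<in> ?S" "c \<noteq> d" for c d
  proof -
    have "c * (f c \<bullet> f d) = (A *v f c) \<bullet> f d"
      using f[OF that(1)] by simp
    also have "\<dots> = f c \<bullet> (A *v f d)"
      by (metis assms dot_lmul_matrix transpose_matrix_vector)
    also have "\<dots> = d * (f c \<bullet> f d)"
      using f[OF that(2)] by simp
    finally show ?thesis
      using that(3) by simp
  qed
  have inj: "inj_on f ?S"
    by (rule inj_onI) (metis f orth inner_eq_zero_iff)
  have "pairwise orthogonal (f ` ?S)"
    unfolding pairwise_def orthogonal_def using orth by blast
  then have "finite (f ` ?S)"
    by (rule pairwise_orthogonal_imp_finite)
  then show ?thesis
    using inj by (rule finite_imageD)
qed

text \<open>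
  The supremum is over a bounded set; it is meaningful when \<open>C\<close> contains a unit vector, which is
  the case wherever it is used.
\<close>
definition cone_norm :: "(real^'n) set \<Rightarrow> real^'n^'n \<Rightarrow> real" where
  "cone_norm C E =
     (SUP (x, y) \<in> (C \<inter> sphere 0 1) \<times> (C \<inter> sphere 0 1). \<bar>x \<bullet> (E *v y)\<bar>)"

definition tangent_cone :: "(real^'n) set \<Rightarrow> real^'n \<Rightarrow> (real^'n) set" where
  "tangent_cone K x = {t *\<^sub>R (v - x) | t v. 0 \<le> t \<and> v \<in> K}"

fun power_iterate :: "(real^'n) set \<Rightarrow> real^'n^'n \<Rightarrow> real^'n \<Rightarrow> nat \<Rightarrow> real^'n" where
  "power_iterate K A w 0 = w"
| "power_iterate K A w (Suc s) =
     (let u = closest_point K (A *v power_iterate K A w s) in u /\<^sub>R norm u)"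

text \<open>
  \<open>power_output K A \<Delta> w v\<close>: the run started at \<open>w\<close> is well defined (no projection vanishes before
  the run stops), stops, and returns \<open>v\<close>.
\<close>
definition power_output ::
    "(real^'n) set \<Rightarrow> real^'n^'n \<Rightarrow> real \<Rightarrow> real^'n \<Rightarrow> real^'n \<Rightarrow> bool" where
  "power_output K A \<Delta> w v \<longleftrightarrow>
     (\<exists>s\<ge>1.
        (\<forall>r<s. closest_point K (A *v power_iterate K A w r) \<noteq> 0) \<and>
        norm (power_iterate K A w s - power_iterate K A w (s - 1)) \<le> \<Delta> \<and>
        (\<forall>r. 1 \<le> r \<and> r < s \<longrightarrow>
           \<not> norm (power_iterate K A w r - power_iterate K A w (r - 1)) \<le> \<Delta>) \<and>
        v = power_iterate K A w s)"

definition c_minus1 :: "real \<Rightarrow> real \<Rightarrow> real" where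
  "c_minus1 \<nu> e = (\<nu> - e - sqrt ((\<nu> - e)\<^sup>2 - 4 * \<nu> * e)) / (2 * \<nu>)"

end

(*
  Both outputs are unit vectors of K. With L = lam I - Abar, the eigengap gives
  nu (1 - (v . xbar)^2) <= v . L v for unit vectors v, so that the smaller distance d of vm to xbar
  and -xbar satisfies nu d^2 / 2 <= vm . L vm. On the other hand
  vp . L vp <= lam |vp - xbar|^2 because L xbar = 0 and Abar is positive semidefinite. The
  comparison of the two values of v . A v then yields
      nu d^2 / 2 <= lam |vp - xbar|^2 + (vm . E vm - vp . E vp).
  Bounding the last term by 2 ||E||_K gives B1. Writing it by symmetry of E as
  (vm - xbar) . E (vm + xbar) - (vp - xbar) . E (vp + xbar) and using that K is contained in its
  tangent cone T at xbar, it is at most 2 ||E||_T (d + |vp - xbar|), which gives B2.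
*)
theory Submission
  imports Defs
begin

section \<open>Eigenvalue lists and the spectral gap of a symmetric matrix\<close>

lemma symmetric_matrix_inner:
  fixes M :: "real^'n^'n"
  assumes "transpose M = M"
  shows "(M *v x) \<bullet> y = x \<bullet> (M *v y)"
  by (metis assms dot_lmul_matrix transpose_matrix_vector)

text \<open>Outside the finite index set the eigenspace is \<open>{0}\<close>, so both sides are 0
  there.\<close>

lemma count_eigenvalues:
  fixes M :: "real^'n^'n"
  assumes "transpose M = M"
  shows "count (eigenvalues M) c = dim (eigenspace M c)"
proof -
  have "count (eigenvalues M) c =
      (\<Sum>d | eigenspace M d \<noteq> {0}. if d = c then dim (eigenspace M d) else 0)"
    unfolding eigenvalues_def count_sum by (intro sum.cong) auto
  also have "\<dots> = (if eigenspace M c \<noteq> {0} then dim (eigenspace M c) else 0)"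
    using finite_eigenvalues[OF assms] by (simp add: sum.delta)
  also have "\<dots> = dim (eigenspace M c)"
    by simp
  finally show ?thesis .
qed

lemma dim_ge_2_if_orthogonal:
  fixes S :: "'a::euclidean_space set"
  assumes "x \<in> S" "y \<in> S" "x \<noteq> 0" "y \<noteq> 0" "x \<bullet> y = 0"
  shows "2 \<le> dim S"
proof -
  have "x \<noteq> y"
    using assms by auto
  have "independent {x, y}"
    using assms by (intro pairwise_orthogonal_independent)
      (auto simp: pairwise_def orthogonal_def inner_commute)
  then have "card {x, y} \<le> dim S"
    using assms by (intro independent_card_le_dim) auto
  then show ?thesis
    using \<open>x \<noteq> y\<close> by simp
qed

text \<open>If \<open>m = eigenvalues_desc M ! 0\<close>, orthogonality makes the eigenvalue at least double.\<close>
lemma orthogonal_eigenvalue_le_second: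
  fixes M :: "real^'n^'n"
  assumes sym: "transpose M = M"
    and x: "x \<noteq> 0" "M *v x = (eigenvalues_desc M ! 0) *\<^sub>R x"
    and y: "y \<noteq> 0" "M *v y = m *\<^sub>R y" "x \<bullet> y = 0"
  shows "m \<le> eigenvalues_desc M ! 1"
proof -
  define ev where "ev = eigenvalues_desc M"
  have mset: "mset ev = eigenvalues M" and sorted: "sorted_wrt (\<ge>) ev"
    by (simp_all add: ev_def eigenvalues_desc_def sorted_wrt_rev)
  have pos: "0 < dim (eigenspace M c)" if "z \<noteq> 0" "M *v z = c *\<^sub>R z" for z c
    using that unfolding eigenspace_def by (auto simp: dim_eq_0 intro!: Nat.gr0I)
  have "2 \<le> dim (eigenspace M m)" if "m = ev ! 0"
    using that x y by (intro dim_ge_2_if_orthogonal[of x _ y]) (auto simp: eigenspace_def ev_def)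
  \<comment> \<open>After removing one copy of \<open>ev ! 0\<close>, \<open>m\<close> survives:
    either it differs from \<open>ev ! 0\<close>, or its multiplicity is at least 2. Hence it lies
    in the tail, whose largest entry is \<open>ev ! 1\<close>.\<close>
  then have "m \<in># mset ev - {#ev ! 0#}"
    using pos[OF y(1,2)] by (auto simp: mset count_eigenvalues[OF sym] simp flip: count_greater_zero_iff)
  moreover have "ev \<noteq> []"
    using pos[OF x] by (auto simp: mset[symmetric] simp flip: count_eigenvalues[OF sym])
  then obtain a l where "ev = a # l"
    by (cases ev) auto
  ultimately have "m \<in> set l"
    by simp
  moreover from this obtain b l' where "l = b # l'"
    by (cases l) auto
  ultimately have "m \<le> ev ! 1"
    using sorted \<open>ev = a # l\<close> by auto
  then show ?thesis
    by (simp add: ev_def)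
qed

text \<open>A maximiser \<open>y\<close> of the Rayleigh quotient on the complement of \<open>x\<close> is an eigenvector: the
  form of \<open>m I - M\<close> is nonnegative there and vanishes at \<open>y\<close>, so it cannot decrease along
  \<open>m y - M y\<close>.\<close>
lemma eigenvector_maximising_on_orthogonal_complement:
  fixes M :: "real^'n^'n"
  assumes sym: "transpose M = M" and x: "M *v x = l *\<^sub>R x" and card: "2 \<le> CARD('n)"
  obtains y m where "norm y = 1" "x \<bullet> y = 0" "M *v y = m *\<^sub>R y"
    "\<And>z. x \<bullet> z = 0 \<Longrightarrow> z \<bullet> (M *v z) \<le> m * (z \<bullet> z)"
proof -
  let ?S = "{z. x \<bullet> z = 0} \<inter> sphere 0 1"
  have "compact ?S"
    by (intro closed_Int_compact closed_hyperplane) simp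
  \<comment> \<open>Dimension at least 2 makes \<open>?S\<close> nonempty, so that a maximum is
    attained.\<close>
  moreover obtain z0 where "z0 \<noteq> 0" "orthogonal x z0"
    using orthogonal_to_vector_exists[of x] card by auto
  then have "z0 /\<^sub>R norm z0 \<in> ?S"
    by (auto simp: orthogonal_def)
  moreover have "continuous_on ?S (\<lambda>z. z \<bullet> (M *v z))"
    by (intro continuous_intros linear_continuous_on) (simp add: linear_linear)
  ultimately obtain y where y: "y \<in> ?S" and max: "\<And>z. z \<in> ?S \<Longrightarrow> z \<bullet> (M *v z) \<le> y \<bullet> (M *v y)"
    using continuous_attains_sup[of ?S "\<lambda>z. z \<bullet> (M *v z)"] by blast
  define m where "m = y \<bullet> (M *v y)"
  have le: "z \<bullet> (M *v z) \<le> m * (z \<bullet> z)" if "x \<bullet> z = 0" for z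
  proof (cases "z = 0")
    case False
    have "(z /\<^sub>R norm z) \<bullet> (M *v (z /\<^sub>R norm z)) \<le> m"
      unfolding m_def using that False by (intro max) auto
    then show ?thesis
      using False by (simp add: matrix_vector_mult_scaleR dot_square_norm power2_eq_square field_simps)
  qed simp
  define w where "w = m *\<^sub>R y - M *v y"
  have xw: "x \<bullet> w = 0"
    using y x symmetric_matrix_inner[OF sym, of x y] by (simp add: w_def inner_diff_right)
  have yy: "y \<bullet> y = 1"
    using y by (simp add: dot_square_norm)
  define b where "b = m * (w \<bullet> w) - w \<bullet> (M *v w)"
  have "b \<ge> 0"
    using le[OF xw] by (simp add: b_def)
  \<comment> \<open>The form of m I - M is evaluated at y + t w: the constant term vanishes by the
    choice of \<open>m\<close>, and the linear coefficient is twice w . (m y - M y) = w . w.\<close>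
  have expand: "0 \<le> 2 * t * (w \<bullet> w) + t\<^sup>2 * b" for t
  proof -
    have ww: "w \<bullet> w = m * (w \<bullet> y) - w \<bullet> (M *v y)"
      by (subst (2) w_def) (simp add: inner_diff_right)
    have "(y + t *\<^sub>R w) \<bullet> (M *v (y + t *\<^sub>R w)) \<le> m * ((y + t *\<^sub>R w) \<bullet> (y + t *\<^sub>R w))"
      using y xw by (intro le) (simp add: inner_add_right)
    then have "0 \<le> 2 * t * (m * (w \<bullet> y) - w \<bullet> (M *v y)) + t\<^sup>2 * b"
      using symmetric_matrix_inner[OF sym, of y w] yy
      by (simp add: b_def m_def[symmetric] inner_add_left inner_add_right matrix_vector_right_distrib
          matrix_vector_mult_scaleR inner_commute algebra_simps power2_eq_square)
    then show ?thesis
      by (simp add: ww)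
  qed
  have "w \<bullet> w = 0"
  proof (rule ccontr)
    assume "w \<bullet> w \<noteq> 0"
    then have pos: "0 < w \<bullet> w"
      by simp
    \<comment> \<open>At t = -s the expansion is s (s b - 2 w . w), negative once s b < w . w. The
      added 1 covers \<open>b = 0\<close>.\<close>
    define s where "s = w \<bullet> w / (b + 1)"
    have s: "0 < s" "s * b < w \<bullet> w"
      using pos \<open>b \<ge> 0\<close> by (auto simp: s_def field_simps)
    have "0 \<le> s * (s * b - 2 * (w \<bullet> w))"
      using expand[of "- s"] by (simp add: algebra_simps power2_eq_square)
    then show False
      using s pos by (simp add: zero_le_mult_iff)
  qed
  then have "M *v y = m *\<^sub>R y"
    by (simp add: w_def)
  then show thesis
    using that[of y m] y le by simp
qed

text \<open>Split \<open>v\<close> into its component along \<open>x\<close> and an orthogonal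
  remainder. The cross terms vanish because \<open>x\<close> is an eigenvector, and on the remainder
  the form is bounded by the second eigenvalue.\<close>

lemma inner_le_eigengap:
  fixes M :: "real^'n^'n"
  assumes sym: "transpose M = M" and card: "2 \<le> CARD('n)"
    and x: "norm x = 1" "M *v x = (eigenvalues_desc M ! 0) *\<^sub>R x" and v: "norm v = 1"
  shows "v \<bullet> (M *v v) \<le> eigenvalues_desc M ! 0 -
    (eigenvalues_desc M ! 0 - eigenvalues_desc M ! 1) * (1 - (v \<bullet> x)\<^sup>2)"
proof -
  let ?l = "eigenvalues_desc M ! 0"
  obtain y m where y: "norm y = 1" "x \<bullet> y = 0" "M *v y = m *\<^sub>R y"
    and le: "\<And>z. x \<bullet> z = 0 \<Longrightarrow> z \<bullet> (M *v z) \<le> m * (z \<bullet> z)"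
    using eigenvector_maximising_on_orthogonal_complement[OF sym x(2) card] by blast
  have m: "m \<le> eigenvalues_desc M ! 1"
    using x y by (intro orthogonal_eigenvalue_le_second[OF sym, of x y]) auto
  define c where "c = v \<bullet> x"
  define w where "w = v - c *\<^sub>R x"
  have xx: "x \<bullet> x = 1" and vv: "v \<bullet> v = 1"
    using x v by (simp_all add: dot_square_norm)
  have xw: "x \<bullet> w = 0"
    using xx by (simp add: w_def c_def inner_diff_right inner_commute)
  have ww: "w \<bullet> w = 1 - c\<^sup>2"
    using xx vv by (simp add: w_def inner_diff_left inner_diff_right c_def inner_commute power2_eq_square)
  have xMw: "x \<bullet> (M *v w) = 0"
    using xw x symmetric_matrix_inner[OF sym, of x w] by simp
  have "v = c *\<^sub>R x + w"
    by (simp add: w_def)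
  then have "v \<bullet> (M *v v) = c\<^sup>2 * ?l + w \<bullet> (M *v w)"
    using xMw xw x(2) xx
    by (simp add: inner_add_left inner_add_right matrix_vector_right_distrib
        matrix_vector_mult_scaleR inner_commute[of w x] power2_eq_square)
  also have "\<dots> \<le> c\<^sup>2 * ?l + (eigenvalues_desc M ! 1) * (w \<bullet> w)"
    using le[OF xw] mult_right_mono[OF m, of "w \<bullet> w"] by simp
  finally show ?thesis
    by (simp add: ww c_def algebra_simps)
qed

section \<open>Cone norms, the tangent cone and the outputs of the iteration\<close>

lemma bdd_above_bilinear_unit:
  fixes E :: "real^'n^'n"
  shows "bdd_above ((\<lambda>(x, y). \<bar>x \<bullet> (E *v y)\<bar>) ` ((C \<inter> sphere 0 1) \<times> (C \<inter> sphere 0 1)))"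
proof (rule bdd_aboveI2, clarify)
  fix x y :: "real^'n"
  assume "x \<in> sphere 0 1" "y \<in> sphere 0 1"
  then show "\<bar>x \<bullet> (E *v y)\<bar> \<le> onorm ((*v) E)"
    using Cauchy_Schwarz_ineq2[of x "E *v y"]
      onorm[OF matrix_vector_mul_bounded_linear, of E y] by simp
qed

text \<open>Both sides are homogeneous in \<open>a\<close> and \<open>b\<close>, so nonzero vectors
  can be normalised inside the cone.\<close>

lemma abs_inner_le_cone_norm:
  fixes E :: "real^'n^'n"
  assumes C: "conic C" and a: "a \<in> C" and b: "b \<in> C"
  shows "\<bar>a \<bullet> (E *v b)\<bar> \<le> cone_norm C E * norm a * norm b"
proof (cases "a = 0 \<or> b = 0")
  case False
  have "a /\<^sub>R norm a \<in> C \<inter> sphere 0 1" "b /\<^sub>R norm b \<in> C \<inter> sphere 0 1"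
    using False conic_mul[OF C] a b by auto
  then have "\<bar>(a /\<^sub>R norm a) \<bullet> (E *v (b /\<^sub>R norm b))\<bar> \<le> cone_norm C E"
    unfolding cone_norm_def
    by (intro cSUP_upper2[OF bdd_above_bilinear_unit, where x = "(a /\<^sub>R norm a, b /\<^sub>R norm b)"]) auto
  then show ?thesis
    using False by (simp add: matrix_vector_mult_scaleR abs_mult field_simps)
qed auto

lemma conic_tangent_cone: "conic (tangent_cone K x)"
  unfolding conic_def tangent_cone_def by clarsimp (metis mult_nonneg_nonneg)

lemma diff_in_tangent_cone: "v \<in> K \<Longrightarrow> v - x \<in> tangent_cone K x"
  unfolding tangent_cone_def by (force intro: exI[of _ 1])

text \<open>Write v = (v + x) - x; a convex cone is closed under addition.\<close>

lemma subset_tangent_cone: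
  assumes "convex_cone K" "x \<in> K"
  shows "K \<subseteq> tangent_cone K x"
proof
  fix v
  assume "v \<in> K"
  then have "(v + x) - x \<in> tangent_cone K x"
    using assms by (intro diff_in_tangent_cone convex_cone_add)
  then show "v \<in> tangent_cone K x"
    by simp
qed

text \<open>Since at least one step is made, the output is a normalised nonzero projection onto
  \<open>K\<close>, even if the start \<open>w\<close> lies outside \<open>K\<close>.\<close>

lemma power_output_in_unit_cone:
  assumes K: "closed K" "convex_cone K" and out: "power_output K A \<Delta> w v"
  shows "v \<in> K" "norm v = 1"
proof -
  obtain s where "s \<ge> 1" and nz: "\<forall>r<s. closest_point K (A *v power_iterate K A w r) \<noteq> 0"
    and v: "v = power_iterate K A w s"
    using out unfolding power_output_def by blast
  then obtain r where r: "s = Suc r"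
    by (cases s) auto
  define u where "u = closest_point K (A *v power_iterate K A w r)"
  have "u \<noteq> 0" "v = u /\<^sub>R norm u"
    using nz v r by (simp_all add: u_def Let_def)
  moreover have "u \<in> K"
    unfolding u_def using K by (intro closest_point_in_set convex_cone_nonempty)
  ultimately show "v \<in> K" "norm v = 1"
    using convex_cone_scaleR[OF K(2), of "inverse (norm u)" u] by auto
qed

section \<open>Distances of unit vectors and auxiliary estimates\<close>

lemma min_dist_sq_le:
  fixes v x :: "'a::real_inner"
  assumes "norm v = 1" "norm x = 1"
  shows "(min (norm (v - x)) (norm (v + x)))\<^sup>2 \<le> 2 * (1 - (v \<bullet> x)\<^sup>2)"
proof -
  let ?c = "v \<bullet> x"
  have "\<bar>?c\<bar> \<le> 1"
    using Cauchy_Schwarz_ineq2[of v x] assms by simp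
  have "v \<bullet> v = 1" "x \<bullet> x = 1"
    using assms by (simp_all add: dot_square_norm)
  then have "(norm (v - x))\<^sup>2 = 2 - 2 * ?c" "(norm (v + x))\<^sup>2 = 2 + 2 * ?c"
    by (simp_all add: power2_norm_eq_inner inner_diff_left inner_diff_right inner_add_left
        inner_add_right inner_commute)
  moreover have "(min (norm (v - x)) (norm (v + x)))\<^sup>2 \<le> (norm (v - x))\<^sup>2"
    "(min (norm (v - x)) (norm (v + x)))\<^sup>2 \<le> (norm (v + x))\<^sup>2"
    by (auto intro!: power_mono)
  \<comment> \<open>The smaller squared distance is 2 (1 - |c|), so this inequality is all that
    remains.\<close>
  moreover have "?c\<^sup>2 \<le> \<bar>?c\<bar>"
    using \<open>\<bar>?c\<bar> \<le> 1\<close> mult_left_mono[of "\<bar>?c\<bar>" 1 "\<bar>?c\<bar>"] by (simp add: power2_eq_square)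
  ultimately show ?thesis
    by (simp add: abs_if split: if_splits)
qed

text \<open>The product is the minimum times the maximum, and the maximum is at most 2.\<close>

lemma norm_diff_mult_norm_add_le:
  fixes v x :: "'a::real_normed_vector"
  assumes "norm v = 1" "norm x = 1"
  shows "norm (v - x) * norm (v + x) \<le> 2 * min (norm (v - x)) (norm (v + x))"
proof -
  have "norm (v - x) \<le> 2" "norm (v + x) \<le> 2"
    using norm_triangle_ineq4[of v x] norm_triangle_ineq[of v x] assms by simp_all
  then show ?thesis
    using mult_left_mono[of "norm (v + x)" 2 "norm (v - x)"]
      mult_right_mono[of "norm (v - x)" 2 "norm (v + x)"] by (simp add: min_def)
qed

text \<open>Otherwise both d - p and d exceed \<open>sqrt q\<close>, so d (d - p) > q, against the
  assumption.\<close>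

lemma le_add_sqrt_if_sq_le:
  fixes d p q :: real
  assumes "d\<^sup>2 \<le> p * d + q" "0 \<le> p" "0 \<le> q"
  shows "d \<le> p + sqrt q"
proof (rule ccontr)
  assume "\<not> d \<le> p + sqrt q"
  then have "sqrt q < d - p"
    by simp
  moreover have "0 \<le> sqrt q"
    using assms(3) by simp
  ultimately have "sqrt q * sqrt q < (d - p) * d"
    using assms(2) by (intro mult_strict_mono; linarith)
  then show False
    using assms by (simp add: algebra_simps power2_eq_square)
qed

text \<open>A difference of two squares: the mixed terms cancel by symmetry.\<close>

lemma inner_diff_eq_if_symmetric:
  fixes M :: "real^'n^'n"
  assumes "transpose M = M"
  shows "v \<bullet> (M *v v) - x \<bullet> (M *v x) = (v - x) \<bullet> (M *v (v + x))"
  using symmetric_matrix_inner[OF assms, of x v]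
  by (simp add: inner_diff_left inner_add_right matrix_vector_right_distrib
      inner_commute[of v "M *v x"])

theorem theorem4p2:
  fixes K :: "(real^'n) set"
    and Abar A E :: "real^'n^'n"
    and xbar v0 vp vm :: "real^'n"
    and lam mu \<nu> c0 \<Delta> :: real
  assumes "CARD('n) \<ge> 2"
    and "closed K" "convex_cone K"
    and "sym_psd Abar"
    and "lam = eigenvalues_desc Abar ! 0" "mu = eigenvalues_desc Abar ! 1"
    and "\<nu> = lam - mu" "\<nu> > 0"
    and "xbar \<in> K \<inter> sphere 0 1" "Abar *v xbar = lam *\<^sub>R xbar"
    and "A = Abar + E" "sym_psd A"
    and "\<nu> \<ge> (3 + 2 * sqrt 2) * cone_norm K E"
    and "v0 \<in> sphere 0 1" "v0 \<bullet> xbar \<ge> c0" "c0 > c_minus1 \<nu> (cone_norm K E)"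
    and "power_output K A \<Delta> v0 vp" "power_output K A \<Delta> (- v0) vm"
    and "vm \<bullet> (A *v vm) \<ge> vp \<bullet> (A *v vp)"
  shows "min (norm (vm - xbar)) (norm (vm + xbar)) \<le>
    min
      (sqrt (2 * lam / \<nu>) * norm (vp - xbar) + sqrt (4 * cone_norm K E / \<nu>))
      (max (8 * cone_norm K E / \<nu>) (8 * cone_norm (tangent_cone K xbar) E / \<nu>)
        + sqrt ((2 * lam * (norm (vp - xbar))\<^sup>2
                  + 8 * norm (vp - xbar) * cone_norm (tangent_cone K xbar) E) / \<nu>))"
proof -
  note K = assms(2,3) and gap_pos = assms(8)
  define d where "d = min (norm (vm - xbar)) (norm (vm + xbar))"
  define \<delta> where "\<delta> = norm (vp - xbar)"
  define e where "e = cone_norm K E"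
  define t where "t = cone_norm (tangent_cone K xbar) E"
  have xbar: "xbar \<in> K" "norm xbar = 1"
    using assms(9) by auto
  have conic: "conic K"
    using K(2) by (simp add: convex_cone_def)
  have vp: "vp \<in> K" "norm vp = 1" and vm: "vm \<in> K" "norm vm = 1"
    using power_output_in_unit_cone[OF K] assms(17,18) by blast+
  have symAbar: "transpose Abar = Abar" and symA: "transpose A = A"
    and psd: "\<And>z. 0 \<le> z \<bullet> (Abar *v z)"
    using assms(4,12) by (simp_all add: sym_psd_def)
  have "E = A - Abar"
    using assms(11) by simp
  then have symE: "transpose E = E"
    using symA symAbar by (simp add: transpose_def vec_eq_iff)
  have Av: "z \<bullet> (A *v z) = z \<bullet> (Abar *v z) + z \<bullet> (E *v z)" for z
    by (simp add: assms(11) matrix_vector_mult_add_rdistrib inner_add_right)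
  have xx: "xbar \<bullet> xbar = 1" and pp: "vp \<bullet> vp = 1"
    using xbar vp by (simp_all add: dot_square_norm)
  have "lam = xbar \<bullet> (Abar *v xbar)"
    using assms(10) xx by simp
  then have lam: "0 \<le> lam"
    using psd by simp
  have d0: "0 \<le> d" and \<delta>0: "0 \<le> \<delta>"
    by (simp_all add: d_def \<delta>_def)
  have e0: "0 \<le> e"
    using abs_inner_le_cone_norm[OF conic xbar(1) xbar(1), of E] xbar by (simp add: e_def)
  have K_sub: "z \<in> tangent_cone K xbar" if "z \<in> K" for z
    using that subset_tangent_cone[OF K(2) xbar(1)] by blast
  have t0: "0 \<le> t"
    using abs_inner_le_cone_norm[OF conic_tangent_cone K_sub[OF xbar(1)] K_sub[OF xbar(1)], of E] xbar
    by (simp add: t_def)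

  \<comment> \<open>Basic inequality for the squared distance\<close>
  have "vm \<bullet> (Abar *v vm) \<le> lam - \<nu> * (1 - (vm \<bullet> xbar)\<^sup>2)"
    using inner_le_eigengap[OF symAbar assms(1) xbar(2) _ vm(2)] assms(5,6,7,10) by simp
  moreover have "\<nu> * d\<^sup>2 \<le> \<nu> * (2 * (1 - (vm \<bullet> xbar)\<^sup>2))"
    unfolding d_def using min_dist_sq_le[OF vm(2) xbar(2)] gap_pos by (intro mult_left_mono) auto
  moreover have "lam - lam * \<delta>\<^sup>2 \<le> vp \<bullet> (Abar *v vp)"
  proof -
    have "0 \<le> (vp - xbar) \<bullet> (Abar *v (vp - xbar))"
      by (rule psd)
    also have "\<dots> = vp \<bullet> (Abar *v vp) - 2 * lam * (vp \<bullet> xbar) + lam"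
      using symmetric_matrix_inner[OF symAbar, of xbar vp] assms(10) xx
      by (simp add: matrix_vector_mult_diff_distrib inner_diff_left inner_diff_right
          inner_commute[of xbar vp] algebra_simps)
    also have "lam * \<delta>\<^sup>2 = 2 * lam - 2 * lam * (vp \<bullet> xbar)"
      unfolding \<delta>_def power2_norm_eq_inner
      by (simp add: inner_diff_left inner_diff_right inner_commute xx pp algebra_simps)
    ultimately show ?thesis
      by simp
  qed
  \<comment> \<open>Twice the comparison of the values of \<open>A\<close> is used, with
    \<open>A\<close> split into \<open>Abar\<close> and \<open>E\<close>; the factor 2 comes from
    \<open>min_dist_sq_le\<close>.\<close>
  ultimately have key: "\<nu> * d\<^sup>2 \<le> 2 * lam * \<delta>\<^sup>2 + 2 * (vm \<bullet> (E *v vm) - vp \<bullet> (E *v vp))"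
    using assms(19) by (simp add: Av algebra_simps)

  \<comment> \<open>Bound through the norm of \<open>E\<close> on \<open>K\<close>\<close>
  have "vm \<bullet> (E *v vm) - vp \<bullet> (E *v vp) \<le> 2 * e"
    using abs_inner_le_cone_norm[OF conic vm(1) vm(1), of E]
      abs_inner_le_cone_norm[OF conic vp(1) vp(1), of E] vm vp by (simp add: e_def)
  then have "\<nu> * d\<^sup>2 \<le> 2 * lam * \<delta>\<^sup>2 + 4 * e"
    using key by simp
  then have "d\<^sup>2 \<le> 2 * lam / \<nu> * \<delta>\<^sup>2 + 4 * e / \<nu>"
    using gap_pos by (simp add: field_simps)
  then have "d \<le> sqrt (2 * lam / \<nu> * \<delta>\<^sup>2 + 4 * e / \<nu>)"
    by (rule real_le_rsqrt)
  also have "\<dots> \<le> sqrt (2 * lam / \<nu> * \<delta>\<^sup>2) + sqrt (4 * e / \<nu>)"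
    using lam gap_pos e0 by (intro sqrt_add_le_add_sqrt) auto
  also have "\<dots> = sqrt (2 * lam / \<nu>) * \<delta> + sqrt (4 * e / \<nu>)"
    using \<delta>0 by (simp only: real_sqrt_mult real_sqrt_abs abs_of_nonneg)
  finally have B1: "d \<le> sqrt (2 * lam / \<nu>) * \<delta> + sqrt (4 * e / \<nu>)" .

  \<comment> \<open>Bound through the norm of \<open>E\<close> on the tangent cone\<close>
  have E_le: "\<bar>z \<bullet> (E *v z) - xbar \<bullet> (E *v xbar)\<bar>
      \<le> t * (2 * min (norm (z - xbar)) (norm (z + xbar)))" if "z \<in> K" "norm z = 1" for z
  proof -
    \<comment> \<open>After factoring, z - xbar is a tangent direction, and z + xbar lies in
      \<open>K\<close>, hence also in the tangent cone.\<close>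
    have "\<bar>z \<bullet> (E *v z) - xbar \<bullet> (E *v xbar)\<bar> \<le> t * norm (z - xbar) * norm (z + xbar)"
      unfolding inner_diff_eq_if_symmetric[OF symE] t_def
      using that K(2) xbar
      by (intro abs_inner_le_cone_norm conic_tangent_cone diff_in_tangent_cone K_sub convex_cone_add)
    also have "\<dots> \<le> t * (2 * min (norm (z - xbar)) (norm (z + xbar)))"
      using mult_left_mono[OF norm_diff_mult_norm_add_le[OF that(2) xbar(2)] t0]
      by (simp add: mult.assoc)
    finally show ?thesis .
  qed
  have "t * (2 * min (norm (vp - xbar)) (norm (vp + xbar))) \<le> t * (2 * \<delta>)"
    using t0 by (intro mult_left_mono) (auto simp: \<delta>_def)
  \<comment> \<open>Both values are compared with xbar . E xbar, which cancels.\<close>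
  then have "vm \<bullet> (E *v vm) - vp \<bullet> (E *v vp) \<le> t * (2 * d) + t * (2 * \<delta>)"
    using E_le[OF vm] E_le[OF vp] unfolding d_def by linarith
  then have "\<nu> * d\<^sup>2 \<le> 2 * lam * \<delta>\<^sup>2 + 4 * t * d + 4 * \<delta> * t"
    using key by (simp add: algebra_simps)
  \<comment> \<open>The constants 4 are enlarged to the 8 of the claimed bound, leaving a quadratic
    inequality in \<open>d\<close>.\<close>
  also have "\<dots> \<le> 8 * t * d + (2 * lam * \<delta>\<^sup>2 + 8 * \<delta> * t)"
    using t0 d0 \<delta>0 by simp
  finally have "d\<^sup>2 \<le> 8 * t / \<nu> * d + (2 * lam * \<delta>\<^sup>2 + 8 * \<delta> * t) / \<nu>"
    using gap_pos by (simp add: field_simps)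
  then have "d \<le> 8 * t / \<nu> + sqrt ((2 * lam * \<delta>\<^sup>2 + 8 * \<delta> * t) / \<nu>)"
    using lam t0 \<delta>0 gap_pos by (intro le_add_sqrt_if_sq_le) auto
  then have "d \<le> max (8 * e / \<nu>) (8 * t / \<nu>) + sqrt ((2 * lam * \<delta>\<^sup>2 + 8 * \<delta> * t) / \<nu>)"
    by linarith
  with B1 show ?thesis
    by (simp add: d_def \<delta>_def e_def t_def)
qed

end
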